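(* Let $p(x)=\sum_{j=0}^n c_jx^j\in\mathbb{C}[x]$ be monic of degree $n\ge 1$ and let $0<\alpha<n$. Let ${}^{C}D_0^{\alpha}p$ be the Caputo fractional derivative of $p$ with base point $0$. Then 1. $M({}^{C}D_0^{\alpha}p)\le \frac{n-\alpha}{n}\lVert p\rVert_1+1$; 2. $M({}^{C}D_0^{\alpha}p)\le \sqrt{n+1}\,\max\left\{\frac{n-\alpha}{n}\lVert p\rVert_\infty,\,1\right\}$; 3. $M({}^{C}D_0^{\alpha}p)\le \frac{n-\alpha}{n}\lVert p\rVert_2+1$.
   Context: For $\alpha>0$ and $m=\lceil\alpha\rceil$, the Caputo fractional derivative with base point $0$ is obtained by differentiating $m$ times and then applying the Riemann-Liouville fractional integral of order $m-\alpha$ (with lower limit $0$; the integral of order $0$ is the identity). For $p(x)=\sum_{j=0}^n c_jx^j$ this gives $${}^{C}D_0^{\alpha}p(x)=\sum_{j=m}^{n} c_j\,\frac{\Gamma(j+1)}{\Gamma(j+1-\alpha)}\,x^{j-\alpha},$$ with $x^{j-\alpha}$ computed with the principal branch of the logarithm. The Mahler measure is $M({}^{C}D_0^{\alpha}p)=\prod_{z}\max\{1,|z|\}$, the product over the zeros $z$ of ${}^{C}D_0^{\alpha}p$ counted with multiplicity. Zeros at $0$ contribute a factor $1$; the nonzero zeros and their multiplicities are those of the polynomial $\sum_{j=m}^n c_j\frac{j!}{\Gamma(j+1-\alpha)}x^j=x^{\alpha}\,{}^{C}D_0^{\alpha}p(x)$. Norms: $\lVert p\rVert_\infty=\max_{0\le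 j\le n}|c_j|$, $\lVert p\rVert_1=\sum_{j=0}^n|c_j|$, $\lVert p\rVert_2=\left(\sum_{j=0}^n|c_j|^2\right)^{1/2}$. *)

theory Defs
  imports "HOL-Complex_Analysis.Complex_Analysis"
begin

text \<open>
  Riemann-Liouville integral of order \<open>\<beta>\<close> with lower limit \<open>0\<close>, at a complex point \<open>x\<close>: the
  integral \<open>1 / \<Gamma>(\<beta>) \<integral> (x - t)^(\<beta> - 1) f(t) dt\<close> along the segment from \<open>0\<close> to \<open>x\<close>, with
  the principal power.  The order \<open>0\<close> is the identity by convention.
  The integrand is singular at the end point \<open>t = x\<close> if \<open>\<beta> < 1\<close>; the underlying integral
  is the gauge integral, so no limit has to be taken.
\<close>
definition RL_integral :: "real \<Rightarrow> (complex \<Rightarrow> complex) \<Rightarrow> complex \<Rightarrow> complex" where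
  "RL_integral \<beta> f x =
     (if \<beta> = 0 then f x
      else contour_integral (linepath 0 x) (\<lambda>t. (x - t) powr of_real (\<beta> - 1) * f t)
             / of_real (Gamma \<beta>))"

definition caputo_deriv :: "real \<Rightarrow> (complex \<Rightarrow> complex) \<Rightarrow> complex \<Rightarrow> complex" where
  "caputo_deriv \<alpha> f =
     (let m = nat \<lceil>\<alpha>\<rceil> in RL_integral (real m - \<alpha>) ((deriv ^^ m) f))"

text \<open>
  For a polynomial \<open>f\<close>, the function \<open>caputo_deriv \<alpha> f\<close> is in general discontinuous across the
  branch cut of the principal power, so the multiplicity of a nonzero zero \<open>z\<close> is taken to be the
  order of vanishing at \<open>z\<close> of the polynomial function \<open>x \<mapsto> x powr \<alpha> * caputo_deriv \<alpha> f x\<close>.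
  Off the cut this is the order of vanishing of \<open>caputo_deriv \<alpha> f\<close> itself.
  A zero at \<open>0\<close> contributes the factor \<open>1\<close>, whatever exponent it is given.
\<close>
definition caputo_zero_mult :: "real \<Rightarrow> (complex \<Rightarrow> complex) \<Rightarrow> complex \<Rightarrow> nat" where
  "caputo_zero_mult \<alpha> f z = nat (zorder (\<lambda>x. x powr of_real \<alpha> * caputo_deriv \<alpha> f x) z)"

text \<open>
  The product runs over the zeros only: there is no factor for a leading coefficient.
\<close>
definition caputo_mahler_measure :: "real \<Rightarrow> (complex \<Rightarrow> complex) \<Rightarrow> real" where
  "caputo_mahler_measure \<alpha> f =
     (\<Prod>z\<in>{z. caputo_deriv \<alpha> f z = 0}. max 1 (cmod z) ^ caputo_zero_mult \<alpha> f z)"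

definition poly_norm_inf :: "complex poly \<Rightarrow> real" where
  "poly_norm_inf p = Max ((\<lambda>j. cmod (coeff p j)) ` {0..degree p})"

definition poly_norm_1 :: "complex poly \<Rightarrow> real" where
  "poly_norm_1 p = (\<Sum>j=0..degree p. cmod (coeff p j))"

definition poly_norm_2 :: "complex poly \<Rightarrow> real" where
  "poly_norm_2 p = sqrt (\<Sum>j=0..degree p. (cmod (coeff p j))\<^sup>2)"

end

theory Submission
  imports Defs "HOL-Computational_Algebra.Fundamental_Theorem_Algebra"
begin

text \<open>
  Multiplied by \<open>x powr \<alpha>\<close>, the Caputo derivative becomes the polynomial \<open>q\<close> with coefficients
  \<open>j! / \<Gamma>(j + 1 - \<alpha>) c\<^sub>j\<close>, so that its Mahler measure is the product over the roots of \<open>q\<close>.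
  After division by the leading coefficient, Landau's inequality bounds it by the \<open>2\<close>-norm, and
  each lower coefficient has become at most \<open>(n - \<alpha>) / n \<bar>c\<^sub>j\<bar>\<close>, because
  \<open>j! \<Gamma>(n + 1 - \<alpha>) / (n! \<Gamma>(j + 1 - \<alpha>))\<close> is the product of the factors \<open>(k - \<alpha>) / k \<le> 1\<close>
  over \<open>j < k \<le> n\<close>.
\<close>

section \<open>Landau's inequality\<close>

lemma poly_norm_2_nonneg: "poly_norm_2 p \<ge> 0"
  by (simp add: poly_norm_2_def sum_nonneg)

lemma poly_norm_2_power2_eq_sum:
  assumes "degree p \<le> d"
  shows "(poly_norm_2 p)\<^sup>2 = (\<Sum>j\<le>d. (cmod (coeff p j))\<^sup>2)"
proof -
  have "(poly_norm_2 p)\<^sup>2 = (\<Sum>j=0..degree p. (cmod (coeff p j))\<^sup>2)"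
    by (simp add: poly_norm_2_def sum_nonneg)
  also have "\<dots> = (\<Sum>j\<le>d. (cmod (coeff p j))\<^sup>2)"
    using assms by (intro sum.mono_neutral_left) (auto simp: coeff_eq_0)
  finally show ?thesis .
qed

text \<open>Both linear factors have the same modulus on the unit circle. In coefficients: the
  squared moduli differ by a fixed multiple of
  \<open>(cmod (u j))\<^sup>2 - (cmod (coeff g j))\<^sup>2\<close>, and these differences sum to
  zero because \<open>u\<close> is the coefficient sequence of \<open>g\<close> shifted by
  one.\<close>

lemma poly_norm_2_reflect_root:
  "poly_norm_2 ([:-a, 1:] * g) = poly_norm_2 ([:-1, cnj a:] * g)"
proof -
  define d where "d = Suc (degree g)"
  define u where "u j = (case j of 0 \<Rightarrow> 0 | Suc i \<Rightarrow> coeff g i)" for j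
  have coeff_l: "coeff ([:-a, 1:] * g) j = u j - a * coeff g j" for j
    by (cases j) (simp_all add: u_def coeff_pCons)
  have coeff_r: "coeff ([:-1, cnj a:] * g) j = cnj a * u j - coeff g j" for j
    by (cases j) (simp_all add: u_def coeff_pCons)
  have deg: "degree ([:-a, 1:] * g) \<le> d" "degree ([:-1, cnj a:] * g) \<le> d"
    by (rule order.trans[OF degree_mult_le], simp add: d_def)+
  \<comment> \<open>As \<open>d\<close> is one more than the degree of \<open>g\<close>, the shifted
    sequence still fits, and the extra coefficient of \<open>g\<close> is 0.\<close>
  have shift: "(\<Sum>j\<le>d. (cmod (u j))\<^sup>2) = (\<Sum>j\<le>d. (cmod (coeff g j))\<^sup>2)"
    unfolding d_def by (subst sum.atMost_Suc_shift) (simp add: u_def coeff_eq_0)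
  have cmod_diff: "(cmod (v - a * w))\<^sup>2 - (cmod (cnj a * v - w))\<^sup>2
      = (1 - (cmod a)\<^sup>2) * ((cmod v)\<^sup>2 - (cmod w)\<^sup>2)" for v w
    by (simp only: cmod_power2, simp add: algebra_simps power2_eq_square)
  have "(poly_norm_2 ([:-a, 1:] * g))\<^sup>2 - (poly_norm_2 ([:-1, cnj a:] * g))\<^sup>2
      = (\<Sum>j\<le>d. (1 - (cmod a)\<^sup>2) * ((cmod (u j))\<^sup>2 - (cmod (coeff g j))\<^sup>2))"
    unfolding poly_norm_2_power2_eq_sum[OF deg(1)] poly_norm_2_power2_eq_sum[OF deg(2)]
      coeff_l coeff_r sum_subtractf[symmetric] cmod_diff ..
  also have "\<dots> = 0"
    by (simp add: sum_distrib_left[symmetric] sum_subtractf shift)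
  finally show ?thesis
    by (simp add: poly_norm_2_nonneg power2_eq_iff_nonneg)
qed

text \<open>
  Replacing a linear factor \<open>x - a\<close> with \<open>\<bar>a\<bar> > 1\<close> by \<open>cnj a x - 1\<close> keeps the \<open>2\<close>-norm and moves
  \<open>\<bar>a\<bar>\<close> into the leading coefficient; the cofactor \<open>g\<close> collects the factors already treated.
\<close>
lemma landau_inequality_multiset:
  "cmod (lead_coeff g) * (\<Prod>a\<in>#A. max 1 (cmod a)) \<le> poly_norm_2 ((\<Prod>a\<in>#A. [:-a, 1:]) * g)"
proof (induction A arbitrary: g)
  case empty
  have "(cmod (lead_coeff g))\<^sup>2 \<le> (poly_norm_2 g)\<^sup>2"
    unfolding poly_norm_2_power2_eq_sum[OF order.refl] by (rule member_le_sum) auto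
  then show ?case
    by (simp add: poly_norm_2_nonneg)
next
  case (add a A)
  show ?case
  proof (cases "cmod a \<le> 1")
    case True
    then have "max 1 (cmod a) = 1" "lead_coeff [:-a, 1:] = 1"
      by simp_all
    then show ?thesis
      using add.IH[of "[:-a, 1:] * g"]
      by (simp only: image_mset_add_mset prod_mset.add_mset lead_coeff_mult mult_ac mult_1_left
        mult_1_right)
  next
    case False
    have "poly_norm_2 ((\<Prod>a\<in>#add_mset a A. [:-a, 1:]) * g)
        = poly_norm_2 ([:-1, cnj a:] * ((\<Prod>a\<in>#A. [:-a, 1:]) * g))"
      unfolding poly_norm_2_reflect_root[symmetric] by (simp only: image_mset_add_mset
        prod_mset.add_mset mult.assoc)
    also have "\<dots> = poly_norm_2 ((\<Prod>a\<in>#A. [:-a, 1:]) * ([:-1, cnj a:] * g))"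
      by (simp only: mult.left_commute)
    also have "\<dots> \<ge> cmod (lead_coeff ([:-1, cnj a:] * g)) * (\<Prod>a\<in>#A. max 1 (cmod a))"
      by (rule add.IH)
    \<comment> \<open>Since \<open>cnj a\<close> is nonzero, the reflected factor still has degree
      1, with leading coefficient \<open>cnj a\<close>.\<close>
    also have "cmod (lead_coeff ([:-1, cnj a:] * g)) = cmod a * cmod (lead_coeff g)"
      using False by (auto simp only: lead_coeff_mult norm_mult) auto
    finally show ?thesis
      using False by (simp add: ac_simps max_def)
  qed
qed

text \<open>Over the complex numbers \<open>p\<close> splits: with all roots taken into the
  multiset, the cofactor is the constant \<open>lead_coeff p\<close>.\<close>

theorem landau_inequality:
  assumes "p \<noteq> 0"
  shows "cmod (lead_coeff p) * (\<Prod>z | poly p z = 0. max 1 (cmod z) ^ order z p) \<le> poly_norm_2 p"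
proof -
  have "(\<Prod>z\<in>#proots p. max 1 (cmod z)) = (\<Prod>z | poly p z = 0. max 1 (cmod z) ^ order z p)"
    using assms by (simp add: image_prod_mset_multiplicity)
  moreover have "(\<Prod>a\<in>#proots p. [:-a, 1:]) * [:lead_coeff p:] = p"
    using complex_poly_decompose_multiset[of p] by (simp add: mult.commute)
  ultimately show ?thesis
    using landau_inequality_multiset[of "[:lead_coeff p:]" "proots p"] by simp
qed

section \<open>The Caputo derivative of a polynomial\<close>

lemma higher_deriv_poly: "(deriv ^^ m) (poly p) = poly ((pderiv ^^ m) p)" for p :: "complex poly"
  by (induction m) (auto intro!: DERIV_imp_deriv)

text \<open>Parametrizing the segment as s * x with 0 < s < 1 leaves Euler's Beta integral of s^k (1
  - s)^(\<beta> - 1). The velocity x of the path raises the power of x from \<beta> - 1 to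
  \<beta>.\<close>

lemma has_contour_integral_RL_power:
  assumes "\<beta> > 0"
  shows "((\<lambda>t. (x - t) powr of_real (\<beta> - 1) * t ^ k) has_contour_integral
           of_real (Beta (real k + 1) \<beta>) * x powr of_real \<beta> * x ^ k) (linepath 0 x)"
proof (cases "x = 0")
  case True
  then show ?thesis by simp
next
  case False
  have pw: "x powr of_real \<beta> = x powr of_real (\<beta> - 1) * x"
    using False by (simp add: powr_diff)
  \<comment> \<open>The open interval avoids t = 0, where for k = 0 the integrands disagree:
    \<open>0 powr 0\<close> is 0, but \<open>0 ^ 0\<close> is 1.\<close>
  have "((\<lambda>t. complex_of_real (t powr (real k + 1 - 1) * (1 - t) powr (\<beta> - 1)) *
           (x powr of_real \<beta> * x ^ k)) has_integral
         of_real (Beta (real k + 1) \<beta>) * (x powr of_real \<beta> * x ^ k)) {0<..<1}"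
    by (intro has_integral_mult_left has_integral_of_real,
        subst has_integral_Icc_iff_Ioo[symmetric], rule has_integral_Beta_real)
       (use assms in auto)
  also have "?this \<longleftrightarrow> ((\<lambda>t. (x - linepath 0 x t) powr of_real (\<beta> - 1) * linepath 0 x t ^ k * (x - 0))
      has_integral of_real (Beta (real k + 1) \<beta>) * (x powr of_real \<beta> * x ^ k)) {0<..<1}"
  proof (intro has_integral_cong)
    fix t :: real assume t: "t \<in> {0<..<1}"
    have "x - linepath 0 x t = of_real (1 - t) * x"
      by (simp add: linepath_def scaleR_conv_of_real algebra_simps)
    \<comment> \<open>The principal power is multiplicative here because \<open>1 - t\<close> is a
      positive real.\<close>
    moreover have "(of_real (1 - t) * x) powr of_real (\<beta> - 1)
        = of_real (1 - t) powr of_real (\<beta> - 1) * x powr of_real (\<beta> - 1)"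
      using t by (intro powr_times_real_left) auto
    moreover have "complex_of_real (1 - t) powr of_real (\<beta> - 1) = of_real ((1 - t) powr (\<beta> - 1))"
      using t by (intro powr_of_real) auto
    ultimately have "(x - linepath 0 x t) powr of_real (\<beta> - 1)
        = of_real ((1 - t) powr (\<beta> - 1)) * x powr of_real (\<beta> - 1)"
      by (simp only:)
    moreover have "linepath 0 x t ^ k = of_real (t powr (real k + 1 - 1)) * x ^ k"
      using t by (simp add: linepath_def scaleR_conv_of_real power_mult_distrib powr_realpow)
    ultimately show "complex_of_real (t powr (real k + 1 - 1) * (1 - t) powr (\<beta> - 1)) *
           (x powr of_real \<beta> * x ^ k)
        = (x - linepath 0 x t) powr of_real (\<beta> - 1) * linepath 0 x t ^ k * (x - 0)"
      by (simp add: pw mult_ac)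
  qed
  finally show ?thesis
    by (simp add: has_contour_integral_linepath has_integral_Icc_iff_Ioo mult.assoc)
qed

text \<open>Termwise, Beta(k + 1, \<beta>) / \<Gamma>(\<beta>) = k! / \<Gamma>(k + 1 + \<beta>). The
  formula also covers the identity at \<beta> = 0, where \<open>x powr 0\<close> is 1 because x is
  nonzero.\<close>

lemma RL_integral_poly:
  assumes "\<beta> \<ge> 0" "x \<noteq> 0"
  shows "RL_integral \<beta> (poly p) x
    = (\<Sum>k\<le>degree p. coeff p k * of_real (fact k / Gamma (real k + 1 + \<beta>)) * x powr of_real \<beta> * x ^ k)"
proof (cases "\<beta> = 0")
  case True
  have "Gamma (real k + 1) = fact k" for k
    using Gamma_fact[of k, where ?'a = real] by (simp add: add.commute)
  then show ?thesis
    using assms True by (simp add: RL_integral_def poly_altdef)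
next
  case False
  then have \<beta>: "\<beta> > 0" using assms by simp
  have "((\<lambda>t. \<Sum>k\<le>degree p. coeff p k * ((x - t) powr of_real (\<beta> - 1) * t ^ k))
      has_contour_integral
        (\<Sum>k\<le>degree p. coeff p k * (of_real (Beta (real k + 1) \<beta>) * x powr of_real \<beta> * x ^ k)))
      (linepath 0 x)"
    by (intro has_contour_integral_sum has_contour_integral_lmul has_contour_integral_RL_power \<beta>) auto
  also have "(\<lambda>t. \<Sum>k\<le>degree p. coeff p k * ((x - t) powr of_real (\<beta> - 1) * t ^ k))
      = (\<lambda>t. (x - t) powr of_real (\<beta> - 1) * poly p t)"
    by (simp add: poly_altdef sum_distrib_left mult_ac)
  finally have "RL_integral \<beta> (poly p) x
    = (\<Sum>k\<le>degree p. coeff p k * (of_real (Beta (real k + 1) \<beta>) * x powr of_real \<beta> * x ^ k))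
      / of_real (Gamma \<beta>)"
    using False by (simp only: RL_integral_def contour_integral_unique if_False)
  also have "\<dots> = (\<Sum>k\<le>degree p.
      coeff p k * of_real (fact k / Gamma (real k + 1 + \<beta>)) * x powr of_real \<beta> * x ^ k)"
    unfolding sum_divide_distrib
  proof (intro sum.cong refl)
    fix k
    have "Gamma \<beta> \<noteq> 0" using Gamma_real_pos[OF \<beta>] by simp
    moreover have "Gamma (real k + 1) = fact k"
      using Gamma_fact[of k, where ?'a = real] by (simp add: add.commute)
    ultimately have Beta: "of_real (Beta (real k + 1) \<beta>) / complex_of_real (Gamma \<beta>)
        = of_real (fact k / Gamma (real k + 1 + \<beta>))"
      unfolding Beta_def of_real_divide[symmetric] by (intro arg_cong[where f = of_real]) simp
    show "coeff p k * (of_real (Beta (real k + 1) \<beta>) * x powr of_real \<beta> * x ^ k)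
        / complex_of_real (Gamma \<beta>)
      = coeff p k * of_real (fact k / Gamma (real k + 1 + \<beta>)) * x powr of_real \<beta> * x ^ k"
      unfolding Beta[symmetric] by (simp only: divide_inverse mult_ac)
  qed
  finally show ?thesis .
qed

text \<open>The sum starts at \<lceil>\<alpha>\<rceil> because differentiation kills the lower
  terms; for non-integer \<alpha> the Gamma quotient alone would not remove them.\<close>

definition caputo_poly :: "real \<Rightarrow> complex poly \<Rightarrow> complex poly" where
  "caputo_poly \<alpha> p = (\<Sum>j=nat \<lceil>\<alpha>\<rceil>..degree p.
     monom (of_real (fact j / Gamma (real j + 1 - \<alpha>)) * coeff p j) j)"

lemma coeff_caputo_poly:
  "coeff (caputo_poly \<alpha> p) j =
     (if nat \<lceil>\<alpha>\<rceil> \<le> j then of_real (fact j / Gamma (real j + 1 - \<alpha>)) * coeff p j else 0)"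
  by (auto simp: caputo_poly_def coeff_sum coeff_eq_0)

lemma powr_mult_caputo_deriv:
  assumes "\<alpha> > 0"
  shows "x powr of_real \<alpha> * caputo_deriv \<alpha> (poly p) x = poly (caputo_poly \<alpha> p) x"
proof (cases "x = 0")
  case True
  \<comment> \<open>As \<alpha> > 0, the index 0 lies below \<lceil>\<alpha>\<rceil>; on the other
    side \<open>0 powr \<alpha>\<close> is 0.\<close>
  have "coeff (caputo_poly \<alpha> p) 0 = 0"
    using assms by (simp add: coeff_caputo_poly)
  then show ?thesis
    using True by (simp add: poly_0_coeff_0)
next
  case False
  define m where "m = nat \<lceil>\<alpha>\<rceil>"
  define \<beta> where "\<beta> = real m - \<alpha>"
  define P where "P = (pderiv ^^ m) p"
  have "\<beta> \<ge> 0" unfolding \<beta>_def m_def by linarith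
  have deg: "degree P = degree p - m" by (simp add: P_def degree_higher_pderiv)
  have "x powr of_real \<alpha> * caputo_deriv \<alpha> (poly p) x = (\<Sum>k\<le>degree P. x powr of_real \<alpha> *
      (coeff P k * of_real (fact k / Gamma (real k + 1 + \<beta>)) * x powr of_real \<beta> * x ^ k))"
    unfolding caputo_deriv_def Let_def m_def[symmetric] \<beta>_def[symmetric] higher_deriv_poly
      P_def[symmetric] RL_integral_poly[OF \<open>\<beta> \<ge> 0\<close> False] sum_distrib_left ..
  also have "\<dots> = (\<Sum>k\<le>degree P. coeff (caputo_poly \<alpha> p) (k + m) * x ^ (k + m))"
  proof (intro sum.cong refl)
    fix k
    have powr: "x powr of_real \<alpha> * x powr of_real \<beta> = x ^ m"
      using False by (simp add: powr_add[symmetric] \<beta>_def powr_nat')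
    \<comment> \<open>The m-fold derivative contributes the rising factorial, which completes k! to
      (k + m)!.\<close>
    have fact: "pochhammer (of_nat (Suc k)) m * fact k = (fact (k + m) :: complex)"
      unfolding pochhammer_fact pochhammer_product'[of 1 k m] by simp
    have arg: "real k + 1 + \<beta> = real (k + m) + 1 - \<alpha>"
      by (simp add: \<beta>_def)
    have "coeff (caputo_poly \<alpha> p) (k + m)
        = fact (k + m) / of_real (Gamma (real (k + m) + 1 - \<alpha>)) * coeff p (k + m)"
      by (simp add: coeff_caputo_poly m_def[symmetric])
    also have "\<dots> * x ^ (k + m) = x powr of_real \<alpha> *
        (coeff P k * of_real (fact k / Gamma (real k + 1 + \<beta>)) * x powr of_real \<beta> * x ^ k)"
      unfolding P_def coeff_higher_pderiv arg of_real_divide of_real_fact power_add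
        powr[symmetric] fact[symmetric] by (simp only: divide_inverse mult_ac)
    finally show "x powr of_real \<alpha> *
        (coeff P k * of_real (fact k / Gamma (real k + 1 + \<beta>)) * x powr of_real \<beta> * x ^ k)
      = coeff (caputo_poly \<alpha> p) (k + m) * x ^ (k + m)" ..
  qed
  also have "\<dots> = (\<Sum>j=m..degree P + m. coeff (caputo_poly \<alpha> p) j * x ^ j)"
    by (rule sum.reindex_bij_witness[of _ "\<lambda>j. j - m" "\<lambda>k. k + m"]) auto
  \<comment> \<open>If \<open>degree p < m\<close>, truncated subtraction leaves the single index m
    on the left, where the coefficient is 0.\<close>
  also have "\<dots> = (\<Sum>j=m..degree p. coeff (caputo_poly \<alpha> p) j * x ^ j)"
    by (intro sum.mono_neutral_right) (auto simp: deg coeff_caputo_poly coeff_eq_0)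
  also have "\<dots> = poly (caputo_poly \<alpha> p) x"
    by (subst (2) caputo_poly_def)
      (auto simp: poly_sum poly_monom m_def coeff_caputo_poly intro!: sum.cong)
  finally show ?thesis .
qed

section \<open>Zeros and their multiplicities\<close>

lemma zorder_poly:
  fixes p :: "complex poly"
  assumes "p \<noteq> 0"
  shows "zorder (poly p) z = int (order z p)"
proof -
  obtain q where q: "p = [:-z, 1:] ^ order z p * q" "\<not> [:-z, 1:] dvd q"
    using order_decomp[OF assms] by blast
  show ?thesis
  proof (rule zorder_eqI[of UNIV z "poly q"])
    show "poly q z \<noteq> 0" using q(2) by (simp add: poly_eq_0_iff_dvd)
    show "poly p w = poly q w * (w - z) powi int (order z p)" for w
      by (subst q(1)) (simp add: poly_power)
  qed (auto intro!: holomorphic_intros)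
qed

text \<open>The two zero sets can differ only at 0, where the polynomial always vanishes, and 0
  contributes the factor 1.\<close>

lemma caputo_mahler_measure_poly:
  assumes "\<alpha> > 0" "caputo_poly \<alpha> p \<noteq> 0"
  shows "caputo_mahler_measure \<alpha> (poly p)
    = (\<Prod>z | poly (caputo_poly \<alpha> p) z = 0. max 1 (cmod z) ^ order z (caputo_poly \<alpha> p))"
proof -
  have "caputo_deriv \<alpha> (poly p) z = 0 \<longleftrightarrow> poly (caputo_poly \<alpha> p) z = 0" if "z \<noteq> 0" for z
    using powr_mult_caputo_deriv[OF assms(1), of z p] that by auto
  moreover have "poly (caputo_poly \<alpha> p) 0 = 0"
    using powr_mult_caputo_deriv[OF assms(1), of 0 p] by simp
  ultimately have "{z. caputo_deriv \<alpha> (poly p) z = 0} \<subseteq> {z. poly (caputo_poly \<alpha> p) z = 0}"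
    "{z. poly (caputo_poly \<alpha> p) z = 0} - {z. caputo_deriv \<alpha> (poly p) z = 0} \<subseteq> {0}"
    by (auto, metis)
  moreover have "caputo_zero_mult \<alpha> (poly p) z = order z (caputo_poly \<alpha> p)" for z
    using assms by (simp add: caputo_zero_mult_def powr_mult_caputo_deriv zorder_poly)
  ultimately show ?thesis
    unfolding caputo_mahler_measure_def
    using assms(2) by (intro prod.mono_neutral_cong_left) (auto simp: poly_roots_finite)
qed

section \<open>Coefficient bounds\<close>

lemma fact_div_Gamma_Suc:
  assumes "\<alpha> < real j + 1"
  shows "fact j / Gamma (real j + 1 - \<alpha>)
    = (real (Suc j) - \<alpha>) / real (Suc j) * (fact (Suc j) / Gamma (real (Suc j) + 1 - \<alpha>))"
proof -
  have "Gamma (real j + 1 - \<alpha>) > 0"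
    using assms by (intro Gamma_real_pos) simp
  moreover have "Gamma (real (Suc j) + 1 - \<alpha>) = (real j + 1 - \<alpha>) * Gamma (real j + 1 - \<alpha>)"
    using Gamma_plus1[of "real j + 1 - \<alpha>"] assms nonpos_Ints_nonpos[of "real j + 1 - \<alpha>"]
    by (force simp: algebra_simps)
  moreover have "real (Suc j) - \<alpha> = real j + 1 - \<alpha>" "(fact (Suc j) :: real) = real (Suc j) * fact j"
    by simp_all
  ultimately show ?thesis
    using assms by (simp only:) simp
qed

lemma fact_div_Gamma_le:
  assumes "j < n" "0 \<le> \<alpha>" "\<alpha> < real j + 1"
  shows "fact j / Gamma (real j + 1 - \<alpha>)
    \<le> (real n - \<alpha>) / real n * (fact n / Gamma (real n + 1 - \<alpha>))"
proof -
  define g :: "nat \<Rightarrow> real" where "g k = fact k / Gamma (real k + 1 - \<alpha>)" for k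
  have g_Suc: "g k = (real (Suc k) - \<alpha>) / real (Suc k) * g (Suc k)" if "k \<ge> j" for k
    unfolding g_def using assms that by (intro fact_div_Gamma_Suc) auto
  have g_pos: "g k > 0" if "k \<ge> j" for k
    unfolding g_def using assms that by (intro divide_pos_pos Gamma_real_pos) auto
  \<comment> \<open>The factors (k - \<alpha>) / k with k < n are bounded by 1; the last one, k = n,
    is kept exactly.\<close>
  have "j \<le> n - 1" using assms by simp
  then have "g j \<le> g (n - 1)"
  proof (induction rule: dec_induct)
    case (step k)
    have "g k \<le> 1 * g (Suc k)"
      using g_Suc[of k] g_pos[of "Suc k"] step.hyps assms
      by (simp only: g_Suc[OF step.hyps(1)], intro mult_right_mono) auto
    then show ?case using step.IH by simp
  qed simp
  also have "\<dots> = (real n - \<alpha>) / real n * g n"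
    using g_Suc[of "n - 1"] assms by simp
  finally show ?thesis by (simp add: g_def)
qed

text \<open>Landau's inequality for \<open>caputo_poly \<alpha> p\<close>, divided by its leading
  coefficient \<open>L\<close>. The leading term 1 stays apart from the damped lower terms, so that
  all three norm bounds can be read off.\<close>

lemma caputo_mahler_measure_power2_le:
  fixes p :: "complex poly"
  defines "n \<equiv> degree p"
  assumes "lead_coeff p = 1" "0 < \<alpha>" "\<alpha> < real n"
  shows "(caputo_mahler_measure \<alpha> (poly p))\<^sup>2
    \<le> 1 + ((real n - \<alpha>) / real n)\<^sup>2 * (\<Sum>j<n. (cmod (coeff p j))\<^sup>2)"
proof -
  define q where "q = caputo_poly \<alpha> p"
  define L where "L = fact n / Gamma (real n + 1 - \<alpha>)"
  define \<rho> where "\<rho> = (real n - \<alpha>) / real n"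
  define M where "M = caputo_mahler_measure \<alpha> (poly p)"
  have "L > 0" unfolding L_def using assms by (intro divide_pos_pos Gamma_real_pos) auto
  have "\<rho> \<ge> 0" using assms by (simp add: \<rho>_def)
  \<comment> \<open>From \<alpha> < n follows \<lceil>\<alpha>\<rceil> \<le> n, so the leading term
    survives the differentiation.\<close>
  have coeff_n: "coeff q n = of_real L"
    using assms by (simp add: q_def coeff_caputo_poly L_def)
  then have "q \<noteq> 0" using \<open>L > 0\<close> by auto
  have "degree q = n"
  proof (rule antisym)
    show "degree q \<le> n"
      by (rule degree_le) (auto simp: q_def coeff_caputo_poly n_def coeff_eq_0)
    show "n \<le> degree q"
      using coeff_n \<open>L > 0\<close> by (intro le_degree) simp
  qed
  have M_nonneg: "M \<ge> 0"
    unfolding M_def caputo_mahler_measure_def by (intro prod_nonneg) auto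
  have coeff_le: "cmod (coeff q j) \<le> L * \<rho> * cmod (coeff p j)" if "j < n" for j
  proof (cases "nat \<lceil>\<alpha>\<rceil> \<le> j")
    case True
    then have "\<alpha> < real j + 1" by linarith
    then have "0 < Gamma (real j + 1 - \<alpha>)" by (intro Gamma_real_pos) simp
    then have "cmod (coeff q j) = fact j / Gamma (real j + 1 - \<alpha>) * cmod (coeff p j)"
      using True by (simp add: q_def coeff_caputo_poly norm_mult norm_divide)
    also have "\<dots> \<le> L * \<rho> * cmod (coeff p j)"
      using fact_div_Gamma_le[OF that, of \<alpha>] \<open>\<alpha> < real j + 1\<close> assms
      by (intro mult_right_mono) (auto simp: L_def \<rho>_def mult.commute)
    finally show ?thesis .
  next
    case False
    then show ?thesis
      using \<open>L > 0\<close> \<open>\<rho> \<ge> 0\<close> by (simp add: q_def coeff_caputo_poly)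
  qed
  have "L * M \<le> poly_norm_2 q"
    using landau_inequality[OF \<open>q \<noteq> 0\<close>] caputo_mahler_measure_poly[of \<alpha> p] coeff_n
      \<open>degree q = n\<close> \<open>q \<noteq> 0\<close> \<open>L > 0\<close> assms by (simp add: M_def q_def)
  then have "(L * M)\<^sup>2 \<le> (poly_norm_2 q)\<^sup>2"
    using \<open>L > 0\<close> M_nonneg by (intro power_mono) auto
  also have "\<dots> = L\<^sup>2 + (\<Sum>j<n. (cmod (coeff q j))\<^sup>2)"
    using poly_norm_2_power2_eq_sum[of q n] \<open>degree q = n\<close> coeff_n
    by (simp flip: lessThan_Suc_atMost)
  also have "(\<Sum>j<n. (cmod (coeff q j))\<^sup>2) \<le> (\<Sum>j<n. (L * \<rho> * cmod (coeff p j))\<^sup>2)"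
    by (intro sum_mono power_mono coeff_le) auto
  also have "\<dots> = L\<^sup>2 * (\<rho>\<^sup>2 * (\<Sum>j<n. (cmod (coeff p j))\<^sup>2))"
    by (simp add: sum_distrib_left power_mult_distrib mult_ac)
  finally have "L\<^sup>2 * M\<^sup>2 \<le> L\<^sup>2 * (1 + \<rho>\<^sup>2 * (\<Sum>j<n. (cmod (coeff p j))\<^sup>2))"
    by (simp add: power_mult_distrib distrib_left)
  then show ?thesis
    using \<open>L > 0\<close> by (simp add: M_def \<rho>_def)
qed

section \<open>From the squared bound to the three norms\<close>

theorem corollary6p2:
  fixes p :: "complex poly" and n :: nat and \<alpha> :: real
  assumes "degree p = n" and "lead_coeff p = 1" and "n \<ge> 1"
    and "0 < \<alpha>" and "\<alpha> < real n"
  shows "caputo_mahler_measure \<alpha> (poly p) \<le> (real n - \<alpha>) / real n * poly_norm_1 p + 1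
    \<and> caputo_mahler_measure \<alpha> (poly p)
        \<le> sqrt (real n + 1) * max ((real n - \<alpha>) / real n * poly_norm_inf p) 1
    \<and> caputo_mahler_measure \<alpha> (poly p) \<le> (real n - \<alpha>) / real n * poly_norm_2 p + 1"
proof -
  define \<rho> where "\<rho> = (real n - \<alpha>) / real n"
  define M where "M = caputo_mahler_measure \<alpha> (poly p)"
  define S where "S = (\<Sum>j<n. (cmod (coeff p j))\<^sup>2)"
  have "\<rho> \<ge> 0" using assms by (simp add: \<rho>_def)
  have M: "M\<^sup>2 \<le> 1 + \<rho>\<^sup>2 * S"
    using caputo_mahler_measure_power2_le[of p \<alpha>] assms by (simp add: M_def \<rho>_def S_def)
  have "(poly_norm_2 p)\<^sup>2 = S + 1"
    using poly_norm_2_power2_eq_sum[of p n] assms by (simp add: S_def flip: lessThan_Suc_atMost)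
  then have "\<rho>\<^sup>2 * S \<le> \<rho>\<^sup>2 * (poly_norm_2 p)\<^sup>2"
    by (intro mult_left_mono) auto
  moreover have "0 \<le> \<rho> * poly_norm_2 p"
    using \<open>\<rho> \<ge> 0\<close> by (simp add: poly_norm_2_nonneg)
  \<comment> \<open>Expanding the square on the right adds only a nonnegative cross term.\<close>
  ultimately have "M\<^sup>2 \<le> (\<rho> * poly_norm_2 p + 1)\<^sup>2"
    using M by (simp add: power2_sum power_mult_distrib)
  then have bound_2: "M \<le> \<rho> * poly_norm_2 p + 1"
    by (rule power2_le_imp_le) (use \<open>0 \<le> \<rho> * poly_norm_2 p\<close> in linarith)
  have "poly_norm_2 p \<le> poly_norm_1 p"
    using L2_set_le_sum[of "{0..degree p}" "\<lambda>j. cmod (coeff p j)"]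
    by (simp add: poly_norm_2_def poly_norm_1_def L2_set_def)
  then have bound_1: "M \<le> \<rho> * poly_norm_1 p + 1"
    using bound_2 mult_left_mono[OF _ \<open>\<rho> \<ge> 0\<close>, of "poly_norm_2 p" "poly_norm_1 p"] by simp
  \<comment> \<open>\<open>K\<close> dominates both the damped lower coefficients and the leading 1,
    so the n + 1 squares sum to at most (n + 1) \<open>K\<^sup>2\<close>.\<close>
  define K where "K = max (\<rho> * poly_norm_inf p) 1"
  have "K \<ge> 1" by (simp add: K_def)
  have "(\<rho> * cmod (coeff p j))\<^sup>2 \<le> K\<^sup>2" if "j < n" for j
  proof (intro power_mono)
    have "cmod (coeff p j) \<le> poly_norm_inf p"
      unfolding poly_norm_inf_def using that assms by (intro Max_ge) auto
    then show "\<rho> * cmod (coeff p j) \<le> K"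
      using mult_left_mono[OF _ \<open>\<rho> \<ge> 0\<close>] by (simp add: K_def le_max_iff_disj)
  qed (use \<open>\<rho> \<ge> 0\<close> in auto)
  then have "(\<Sum>j<n. (\<rho> * cmod (coeff p j))\<^sup>2) \<le> (\<Sum>j<n. K\<^sup>2)"
    by (intro sum_mono) auto
  then have "\<rho>\<^sup>2 * S \<le> real n * K\<^sup>2"
    by (simp add: S_def sum_distrib_left power_mult_distrib)
  moreover have "1 \<le> K\<^sup>2"
    using \<open>K \<ge> 1\<close> by simp
  ultimately have "M\<^sup>2 \<le> (sqrt (real n + 1) * K)\<^sup>2"
    using M by (simp add: power_mult_distrib distrib_right)
  then have "M \<le> sqrt (real n + 1) * K"
    by (rule power2_le_imp_le) (use \<open>K \<ge> 1\<close> in simp)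
  then show ?thesis
    using bound_1 bound_2 by (simp add: M_def \<rho>_def K_def)
qed

end
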